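(* Let $(X,J)\in\mathbb{K}^{n\times 2n}\times\mathbb{K}^{2n\times 2n}$ with $J$ nonsingular. Then $(X,J)$ is a standard pair of a $(\star,\epsilon)$-palindromic quadratic matrix polynomial $P(\lambda)=\lambda^2A+\lambda Q+\epsilon A^{\star}$ (with $A,Q\in\mathbb{K}^{n\times n}$, $A$ nonsingular, $Q^{\star}=\epsilon Q$) if and only if the matrix $X_L=\begin{bmatrix}X\\ XJ\end{bmatrix}$ is nonsingular and there is a nonsingular matrix $\Gamma\in\mathcal{S}_{(J,\star,\epsilon)}$ satisfying $$X\Gamma X^{\star}=0.$$ In that case the coefficient matrices can be given by $$A=(XJ\Gamma X^{\star})^{-1},\qquad Q=-AXJ^2\Gamma X^{\star}A,\qquad\text{with } Q^{\star}=\epsilon Q;$$ that is, if $X_L$ is nonsingular, every nonsingular $\Gamma\in\mathcal{S}_{(J,\star,\epsilon)}$ with $X\Gamma X^{\star}=0$ defines through these formulas (well-defined) matrices $A,Q$ with $Q^\star=\epsilon Q$ such that $(X,J)$ is a standard pair of $\lambda^2A+\lambda Q+\epsilon A^\star$, and if $(X,J)$ is a standard pair of such a $P(\lambda)$ then its coefficients $A,Q$ are of this form for some such $\Gamma$.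
   Context: $\mathbb{K}\in\{\mathbb{R},\mathbb{C}\}$, $\epsilon\in\{1,-1\}$, and $\star\in\{H,T\}$ denotes conjugate transpose or transpose; $B^{-\star}=(B^{-1})^{\star}$. A $(\star,\epsilon)$-palindromic quadratic matrix polynomial is $P(\lambda)=\lambda^2A+\lambda Q+\epsilon A^{\star}$ with $A,Q\in\mathbb{K}^{n\times n}$ and $Q^{\star}=\epsilon Q$. It is assumed throughout that $A$ is nonsingular. A pair $(X,J)\in\mathbb{K}^{n\times 2n}\times\mathbb{K}^{2n\times 2n}$ is a standard pair of $P(\lambda)$ if $\begin{bmatrix}X\\ XJ\end{bmatrix}$ is nonsingular and $AXJ^2+QXJ+\epsilon A^{\star}X=0$. For a nonsingular $B\in\mathbb{K}^{m\times m}$, $$\mathcal{S}_{(B,\star,\epsilon)}=\{S\in\mathbb{K}^{m\times m}: S^{\star}=-\epsilon S,\ BS=SB^{-\star}\}.$$ *)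

theory Defs
  imports
    "HOL-Analysis.Analysis"
    "HOL-Computational_Algebra.Polynomial"
    "Jordan_Normal_Form.Conjugate"
begin

(* The ground field K: a type of this class is the field of the reals with trivial conjugation or
   the field of the complex numbers with complex conjugation, up to isomorphism over the reals.
   See real_or_complex_cases for the fact that there is no third case. *)
class real_or_complex = real_field + conjugatable_field +
  assumes conjugate_fixed_scaleR: "conjugate x = x \<longleftrightarrow> (\<exists>a. x = a *\<^sub>R 1)"

lemma conjugate_fixed_iff:
  fixes x :: "'a :: real_or_complex"
  shows "conjugate x = x \<longleftrightarrow> x \<in> range of_real"
  using conjugate_fixed_scaleR[of x] by (auto simp: of_real_def)

instance real :: real_or_complex
  by intro_classes auto

instance complex :: real_or_complex
proof
  fix x :: complex
  show "conjugate x = x \<longleftrightarrow> (\<exists>a. x = a *\<^sub>R 1)"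
    using Reals_cnj_iff[of x] by (auto simp: Reals_def of_real_def)
qed

lemma real_or_complex_cases:
  "(\<forall>x :: 'a :: real_or_complex. \<exists>a. x = of_real a \<and> conjugate x = x) \<or>
   (\<exists>i :: 'a. i * i = - 1 \<and>
     (\<forall>x. \<exists>a b. x = of_real a + of_real b * i \<and> conjugate x = of_real a - of_real b * i))"
proof (cases "\<forall>x :: 'a. conjugate x = x")
  case True
  then show ?thesis using conjugate_fixed_iff by blast
next
  case False
  then obtain x :: 'a where x: "conjugate x \<noteq> x" by blast
  have fixed: "conjugate (of_real a :: 'a) = of_real a" for a
    using conjugate_fixed_iff by blast
  define y where "y = x - conjugate x"
  have y0: "y \<noteq> 0" using x by (simp add: y_def)
  have cy: "conjugate y = - y"
    unfolding y_def
    using conjugate_dist_add[of x "- conjugate x"] by (simp add: conjugate_neg)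
  have "conjugate (y * y) = y * y" by (simp add: conjugate_dist_mul cy)
  then obtain r where r: "y * y = of_real r" using conjugate_fixed_iff by blast
  have "r < 0"
  proof (rule ccontr)
    assume "\<not> r < 0"
    then have "y * y = of_real (sqrt r) * of_real (sqrt r)"
      by (simp add: r flip: of_real_mult)
    then have "y = of_real (sqrt r) \<or> y = - of_real (sqrt r)"
      by (simp add: square_eq_iff)
    then have "conjugate y = y" using fixed by (auto simp: conjugate_neg)
    with cy have "y + y = 0" by simp
    then have "2 * y = 0" by (metis mult_2)
    with y0 show False by simp
  qed
  define i where "i = y * of_real (1 / sqrt (- r))"
  have ii: "i * i = - 1"
  proof -
    have "i * i = (y * y) * of_real ((1 / sqrt (- r)) * (1 / sqrt (- r)))"
      by (simp only: i_def of_real_mult mult_ac)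
    also have "\<dots> = of_real (r * ((1 / sqrt (- r)) * (1 / sqrt (- r))))"
      by (simp only: r of_real_mult)
    also have "r * ((1 / sqrt (- r)) * (1 / sqrt (- r))) = - 1"
      using \<open>r < 0\<close> by (simp add: field_simps)
    finally show ?thesis by simp
  qed
  have ci: "conjugate i = - i" by (simp add: i_def conjugate_dist_mul cy fixed del: of_real_divide)
  have "\<exists>a b. z = of_real a + of_real b * i \<and> conjugate z = of_real a - of_real b * i" for z :: 'a
  proof -
    have half: "conjugate (1 / 2 :: 'a) = 1 / 2" using fixed[of "1 / 2"] by simp
    have "conjugate ((z + conjugate z) * (1 / 2)) = (z + conjugate z) * (1 / 2)"
      by (simp only: conjugate_dist_mul conjugate_dist_add conjugate_id half add.commute)
    then obtain a where a: "(z + conjugate z) * (1 / 2) = of_real a"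
      using conjugate_fixed_iff by blast
    have "conjugate (i * (conjugate z + - z) * (1 / 2)) = i * (conjugate z + - z) * (1 / 2)"
      by (simp only: conjugate_dist_mul conjugate_dist_add conjugate_neg conjugate_id half ci)
        (simp add: algebra_simps)
    then obtain b where b: "i * (conjugate z + - z) * (1 / 2) = of_real b"
      using conjugate_fixed_iff by blast
    have "of_real b * i = (i * i) * ((conjugate z - z) * (1 / 2))"
      by (simp flip: b add: mult_ac)
    then have bi: "of_real b * i = (z - conjugate z) * (1 / 2)"
      by (simp add: ii field_simps)
    have "z = of_real a + of_real b * i" "conjugate z = of_real a - of_real b * i"
      unfolding bi by (simp_all flip: a add: field_simps)
    then show ?thesis by blast
  qed
  with ii show ?thesis by blast
qed

datatype star = Conj_Transpose | Transpose

primrec mstar :: "star \<Rightarrow> 'a::conjugatable_field^'n^'m \<Rightarrow> 'a^'m^'n" where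
  "mstar Conj_Transpose B = map_matrix conjugate (transpose B)"
| "mstar Transpose B = transpose B"

definition stack :: "'a^'k^'m \<Rightarrow> 'a^'k^'n \<Rightarrow> 'a^'k^('m + 'n)" where
  "stack B C = (\<chi> i. case i of Inl j \<Rightarrow> B $ j | Inr j \<Rightarrow> C $ j)"

(* Matrix polynomials are polynomials with matrix coefficients, listed from the constant term up.
   The type 'n + 'n indexes the 2n columns of X. *)
definition palindromic_poly ::
    "star \<Rightarrow> real \<Rightarrow> 'a::real_or_complex^'n^'n \<Rightarrow> 'a^'n^'n \<Rightarrow> ('a^'n^'n) poly" where
  "palindromic_poly s \<epsilon> A Q = [: \<epsilon> *\<^sub>R mstar s A, Q, A :]"

definition standard_pair ::
    "('a::real_or_complex^'n^'n) poly \<Rightarrow> 'a^('n + 'n)^'n \<Rightarrow> 'a^('n + 'n)^('n + 'n) \<Rightarrow> bool" where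
  "standard_pair P X J \<longleftrightarrow>
     invertible (stack X (X ** J)) \<and>
     coeff P 2 ** X ** (J ** J) + coeff P 1 ** X ** J + coeff P 0 ** X = 0"

definition S_set :: "'a::real_or_complex^'m^'m \<Rightarrow> star \<Rightarrow> real \<Rightarrow> ('a^'m^'m) set" where
  "S_set B s \<epsilon> = {S. mstar s S = - (\<epsilon> *\<^sub>R S) \<and> B ** S = S ** mstar s (matrix_inv B)}"

end

theory Submission
  imports Defs
begin

text \<open>
  Write \<open>L\<close> for the stack of \<open>X\<close> over \<open>X J\<close>. A parameter \<open>\<Gamma>\<close> is skew,
  \<open>\<Gamma>\<^sup>\<star> = - \<epsilon> \<Gamma>\<close>, and for nonsingular \<open>J\<close> its other condition is the congruence
  \<open>J \<Gamma> J\<^sup>\<star> = \<Gamma>\<close>. Together with \<open>X \<Gamma> X\<^sup>\<star> = 0\<close> and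
  \<open>X J \<Gamma> X\<^sup>\<star> = A\<^sup>-\<^sup>1\<close> they determine all four blocks of \<open>L \<Gamma> L\<^sup>\<star>\<close>: the diagonal blocks
  vanish and the other two are \<open>A\<^sup>-\<^sup>1\<close> and \<open>- \<epsilon> (A\<^sup>-\<^sup>1)\<^sup>\<star>\<close>. Inverting \<open>L \<Gamma> L\<^sup>\<star>\<close> shows
  what \<open>\<Gamma>\<close> has to be, namely the inverse of
  \<open>H = X\<^sup>\<star> A X J - \<epsilon> (A X J)\<^sup>\<star> X\<close>.

  For a standard pair, \<open>H\<close> therefore serves as the definition of \<open>\<Gamma>\<close>
  (\<open>parameter_of_standard_pair\<close>). Its skewness is visible, and \<open>J\<^sup>\<star> H J = H\<close> is what the
  equation of the standard pair and \<open>Q\<^sup>\<star> = \<epsilon> Q\<close> say (\<open>palindromic_form_invariant\<close>).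
  Nonsingularity and the two equations for \<open>\<Gamma>\<close> come from the solution \<open>Y\<close> of \<open>X Y = 0\<close>,
  \<open>X J Y = A\<^sup>-\<^sup>1\<close>: it satisfies \<open>H Y = X\<^sup>\<star>\<close>, and then \<open>H J\<^sup>-\<^sup>1 Y = J\<^sup>\<star> X\<^sup>\<star>\<close>.

  Conversely, given \<open>\<Gamma>\<close>, the columns of \<open>\<Gamma> X\<^sup>\<star>\<close> and \<open>\<Gamma> J\<^sup>\<star> X\<^sup>\<star>\<close> span the whole space,
  because these two blocks make up \<open>\<Gamma> L\<^sup>\<star>\<close>. Thus \<open>A X J\<^sup>2 + Q X J + \<epsilon> A\<^sup>\<star> X = 0\<close> needs to be
  checked only after multiplication by them: the first product vanishes by the choice of \<open>Q\<close>, the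
  second one by congruence and skewness. Multiplying once more, by \<open>\<Gamma> (J\<^sup>\<star>)\<^sup>2 X\<^sup>\<star>\<close>, yields another
  formula for \<open>Q\<close>, and comparing the two formulas gives \<open>Q\<^sup>\<star> = \<epsilon> Q\<close>
  (\<open>standard_pair_of_parameter\<close>).
\<close>

section \<open>Matrix arithmetic and the operation star\<close>

lemma matrix_minus_left: "(- A) ** B = - (A ** B)"
  for A :: "'a::ring_1^'n^'m"
  by (simp add: matrix_matrix_mult_def vec_eq_iff sum_negf)

lemma matrix_minus_right: "A ** (- B) = - (A ** B)"
  for A :: "'a::ring_1^'n^'m"
  by (simp add: matrix_matrix_mult_def vec_eq_iff sum_negf)

lemma matrix_add_rdistrib: "(A + B) ** C = A ** C + B ** C"
  for A :: "'a::semiring_1^'n^'m"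
  by (simp add: matrix_matrix_mult_def vec_eq_iff algebra_simps sum.distrib)

lemma matrix_diff_ldistrib: "A ** (B - C) = A ** B - A ** C"
  for A :: "'a::ring_1^'n^'m"
  by (simp add: matrix_matrix_mult_def vec_eq_iff algebra_simps sum_subtractf)

lemma matrix_diff_rdistrib: "(A - B) ** C = A ** C - B ** C"
  for A :: "'a::ring_1^'n^'m"
  by (simp add: matrix_matrix_mult_def vec_eq_iff algebra_simps sum_subtractf)

lemma matrix_scaleR_left: "(k *\<^sub>R A) ** B = k *\<^sub>R (A ** B)"
  for A :: "'a::real_algebra_1^'n^'m"
  by (simp add: scalar_matrix_assoc)

lemma matrix_scaleR_right: "A ** (k *\<^sub>R B) = k *\<^sub>R (A ** B)"
  for A :: "'a::real_algebra_1^'n^'m"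
  by (simp add: matrix_scalar_ac scalar_matrix_assoc)

lemmas matrix_bilinear =
  matrix_add_ldistrib matrix_add_rdistrib matrix_minus_left matrix_minus_right
  matrix_diff_ldistrib matrix_diff_rdistrib matrix_scaleR_left matrix_scaleR_right

lemma matrix_inv_right: "invertible A \<Longrightarrow> A ** matrix_inv A = mat 1"
  and matrix_inv_left: "invertible A \<Longrightarrow> matrix_inv A ** A = mat 1"
  unfolding invertible_def matrix_inv_def by (rule someI2_ex, blast, blast)+

lemma matrix_inv_eqI:
  fixes A :: "'a::field^'n^'n"
  assumes "A ** B = mat 1"
  shows "matrix_inv A = B"
proof -
  have "invertible A" using assms by (auto simp: invertible_right_inverse)
  then have "matrix_inv A ** (A ** B) = B"
    by (simp add: matrix_mul_assoc matrix_inv_left)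
  then show ?thesis by (simp add: assms)
qed

lemma invertible_matrix_inv: "invertible A \<Longrightarrow> invertible (matrix_inv A)"
  by (metis invertible_def matrix_inv_left matrix_inv_right)

lemma invertible_left_cancel: "U = V" if "invertible L" "L ** U = L ** V"
  by (metis that matrix_inv_left matrix_mul_assoc matrix_mul_lid)

text \<open>
  The class fixes the conjugation only through its fixed points; that it is real-linear, and so
  commutes with the scalar \<open>\<epsilon>\<close>, follows because these fixed points are the embedded reals.
\<close>
lemma conjugate_of_real: "conjugate (of_real a) = (of_real a :: 'a::real_or_complex)"
  using conjugate_fixed_iff by blast

lemma conjugate_scaleR: "conjugate (a *\<^sub>R x) = a *\<^sub>R conjugate x"
  for x :: "'a::real_or_complex"
  by (simp add: scaleR_conv_of_real conjugate_dist_mul conjugate_of_real)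

lemma conjugate_1: "conjugate 1 = (1 :: 'a::real_or_complex)"
  using conjugate_of_real[of 1, where 'a = 'a] by simp

lemma conjugate_minus: "conjugate (x - y) = conjugate x - conjugate y"
  for x :: "'a::real_or_complex"
  using conjugate_dist_add[of x "- y"] by (simp add: conjugate_neg)

lemma mstar_mult: "mstar s (A ** B) = mstar s B ** mstar s A"
  for A :: "'a::real_or_complex^'n^'m" and B :: "'a^'k^'n"
  by (cases s)
    (simp_all add: matrix_matrix_mult_def transpose_def map_matrix_def vec_eq_iff sum_conjugate
      conjugate_dist_mul mult.commute)

lemma mstar_mstar: "mstar s (mstar s A) = A"
  by (cases s) (simp_all add: transpose_def map_matrix_def vec_eq_iff)

lemma mstar_linear:
  fixes A B :: "'a::real_or_complex^'n^'m"
  shows "mstar s (A + B) = mstar s A + mstar s B"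
    and "mstar s (A - B) = mstar s A - mstar s B"
    and "mstar s (- A) = - mstar s A"
    and "mstar s (k *\<^sub>R A) = k *\<^sub>R mstar s A"
    and "mstar s (0 :: 'a^'n^'m) = 0"
  by (cases s; simp add: transpose_def map_matrix_def vec_eq_iff conjugate_dist_add
      conjugate_minus conjugate_neg conjugate_scaleR)+

lemma mstar_mat_1: "mstar s (mat 1) = (mat 1 :: 'a::real_or_complex^'n^'n)"
  by (cases s) (simp_all add: transpose_def map_matrix_def mat_def vec_eq_iff conjugate_1)

lemmas mstar_simps = mstar_mult mstar_mstar mstar_linear mstar_mat_1

lemma invertible_mstar: "invertible A \<Longrightarrow> invertible (mstar s A)"
  for A :: "'a::real_or_complex^'n^'n"
  unfolding invertible_def by (metis mstar_mult mstar_mat_1)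

lemma mstar_matrix_inv:
  fixes A :: "'a::real_or_complex^'n^'n"
  assumes "invertible A"
  shows "mstar s (matrix_inv A) = matrix_inv (mstar s A)"
  using assms by (metis matrix_inv_eqI matrix_inv_left mstar_mult mstar_mat_1)

section \<open>Stacked matrices\<close>

lemma stack_mult: "stack B C ** D = stack (B ** D) (C ** D)"
  by (auto simp: stack_def matrix_matrix_mult_def vec_eq_iff split: sum.split)

lemma stack_eq_iff: "stack B C = stack D E \<longleftrightarrow> B = D \<and> C = E"
proof
  assume eq: "stack B C = stack D E"
  have "B $ i = D $ i" for i using arg_cong[OF eq, of "\<lambda>M. M $ Inl i"] by (simp add: stack_def)
  moreover have "C $ i = E $ i" for i
    using arg_cong[OF eq, of "\<lambda>M. M $ Inr i"] by (simp add: stack_def)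
  ultimately show "B = D \<and> C = E" by (simp add: vec_eq_iff)
qed simp

text \<open>
  The next two lemmas let an invertible stack be used one block at a time: equations may be tested
  on the two blocks, and the values on the two blocks may be prescribed.
\<close>
lemma stack_left_cancel:
  assumes "invertible (stack B C)" "B ** U = B ** V" "C ** U = C ** V"
  shows "U = V"
  using assms by (metis invertible_left_cancel stack_mult)

lemma stack_solvable:
  assumes "invertible (stack B C)"
  obtains Y where "B ** Y = F" "C ** Y = G"
proof
  let ?Y = "matrix_inv (stack B C) ** stack F G"
  have "stack B C ** ?Y = stack F G"
    using assms by (simp add: matrix_mul_assoc matrix_inv_right)
  then show "B ** ?Y = F" "C ** ?Y = G" by (simp_all add: stack_mult stack_eq_iff)
qed

section \<open>From a standard pair to the parameter\<close>

lemma standard_pair_palindromic: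
  "standard_pair (palindromic_poly s \<epsilon> A Q) X J \<longleftrightarrow>
     invertible (stack X (X ** J)) \<and>
     A ** X ** J ** J + Q ** X ** J + \<epsilon> *\<^sub>R (mstar s A ** X) = 0"
  by (simp add: standard_pair_def palindromic_poly_def numeral_2_eq_2 matrix_mul_assoc
      matrix_scaleR_left)

text \<open>
  The matrix \<open>L\<^sup>\<star> W L\<close>, where \<open>L\<close> is the stack of \<open>X\<close> over \<open>X J\<close> and \<open>W\<close> has zero diagonal
  blocks, upper right block \<open>A\<close> and lower left block \<open>- \<epsilon> A\<^sup>\<star>\<close>. Multiplying out the blocks
  leaves an expression without any stack. It is the inverse of the parameter belonging to \<open>A\<close>.
\<close>
definition palindromic_form ::
    "star \<Rightarrow> real \<Rightarrow> 'a::real_or_complex^'n^'n \<Rightarrow> 'a^'m^'n \<Rightarrow> 'a^'m^'m \<Rightarrow> 'a^'m^'m" where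
  "palindromic_form s \<epsilon> A X J =
     mstar s X ** (A ** X ** J) - \<epsilon> *\<^sub>R (mstar s (A ** X ** J) ** X)"

lemma mstar_palindromic_form:
  assumes "\<epsilon> * \<epsilon> = 1"
  shows "mstar s (palindromic_form s \<epsilon> A X J) = - (\<epsilon> *\<^sub>R palindromic_form s \<epsilon> A X J)"
  using assms by (simp add: palindromic_form_def mstar_simps algebra_simps)

text \<open>
  \<open>J\<close> is an isometry of the form. In \<open>J\<^sup>\<star> H J\<close> the polynomial equation replaces
  \<open>A X J\<^sup>2\<close> by \<open>- Q X J - \<epsilon> A\<^sup>\<star> X\<close>; the two terms containing \<open>Q\<close> cancel since \<open>Q\<^sup>\<star> = \<epsilon> Q\<close>,
  and the terms containing \<open>A\<^sup>\<star>\<close> and \<open>A\<close> are those of \<open>H\<close> in exchanged order.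
\<close>
lemma palindromic_form_invariant:
  fixes X :: "'a::real_or_complex^'m^'n"
  assumes eps: "\<epsilon> * \<epsilon> = 1"
    and Q: "mstar s Q = \<epsilon> *\<^sub>R Q"
    and root: "A ** X ** J ** J + Q ** X ** J + \<epsilon> *\<^sub>R (mstar s A ** X) = 0"
  shows "mstar s J ** palindromic_form s \<epsilon> A X J ** J = palindromic_form s \<epsilon> A X J"
proof -
  define V where "V = X ** J"
  define W where "W = A ** X ** J ** J"
  have W: "W = - (Q ** V) - \<epsilon> *\<^sub>R (mstar s A ** X)"
    using root unfolding W_def V_def by (simp add: matrix_mul_assoc algebra_simps eq_neg_iff_add_eq_0)
  have "mstar s J ** palindromic_form s \<epsilon> A X J ** J = mstar s V ** W - \<epsilon> *\<^sub>R (mstar s W ** V)"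
    by (simp add: palindromic_form_def V_def W_def mstar_simps matrix_bilinear matrix_mul_assoc)
  also have "\<dots> = mstar s X ** A ** V - \<epsilon> *\<^sub>R (mstar s V ** mstar s A ** X)"
    by (simp add: W mstar_simps matrix_bilinear matrix_mul_assoc Q eps algebra_simps)
  also have "\<dots> = palindromic_form s \<epsilon> A X J"
    by (simp add: palindromic_form_def V_def mstar_simps matrix_mul_assoc)
  finally show ?thesis .
qed

lemma parameter_of_standard_pair:
  fixes X :: "'a::real_or_complex^('n::finite + 'n)^'n"
  assumes eps: "\<epsilon> * \<epsilon> = 1"
    and J: "invertible J"
    and A: "invertible A"
    and Q: "mstar s Q = \<epsilon> *\<^sub>R Q"
    and pair: "standard_pair (palindromic_poly s \<epsilon> A Q) X J"
  obtains \<Gamma> where "\<Gamma> \<in> S_set J s \<epsilon>" "invertible \<Gamma>" "X ** \<Gamma> ** mstar s X = 0"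
    "X ** J ** \<Gamma> ** mstar s X = matrix_inv A"
proof
  define H where "H = palindromic_form s \<epsilon> A X J"
  define \<Gamma> where "\<Gamma> = matrix_inv H"
  define Ji where "Ji = matrix_inv J"
  have L: "invertible (stack X (X ** J))"
    and root: "A ** X ** J ** J + Q ** X ** J + \<epsilon> *\<^sub>R (mstar s A ** X) = 0"
    using pair by (auto simp: standard_pair_palindromic)
  have skew: "mstar s H = - (\<epsilon> *\<^sub>R H)"
    unfolding H_def by (rule mstar_palindromic_form[OF eps])
  have JHJ: "mstar s J ** H ** J = H"
    unfolding H_def by (rule palindromic_form_invariant[OF eps Q root])
  have JJi: "J ** Ji = mat 1" "Ji ** J = mat 1"
    unfolding Ji_def using J by (simp_all add: matrix_inv_left matrix_inv_right)
  obtain Y where XY: "X ** Y = 0" and XJY: "X ** J ** Y = matrix_inv A"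
    using stack_solvable[OF L] by metis
  \<comment> \<open>\<open>Y\<close> is the matrix that \<open>\<Gamma> X\<^sup>\<star>\<close> has to be, by the two equations to be shown for \<open>\<Gamma>\<close>.\<close>
  have HY: "H ** Y = mstar s X"
  proof -
    have "H ** Y = mstar s X ** (A ** (X ** J ** Y)) - \<epsilon> *\<^sub>R (mstar s (A ** X ** J) ** (X ** Y))"
      by (simp add: H_def palindromic_form_def matrix_bilinear matrix_mul_assoc)
    then show ?thesis using A by (simp add: XY XJY matrix_inv_right)
  qed
  have HJiY: "H ** (Ji ** Y) = mstar s (X ** J)"
  proof -
    have "H ** Ji = mstar s J ** H"
      using JHJ JJi by (metis matrix_mul_assoc matrix_mul_rid)
    then show ?thesis by (metis HY matrix_mul_assoc mstar_mult)
  qed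
  \<comment> \<open>By the two equations above \<open>H\<close> is a left factor of the star of the invertible stack.\<close>
  have invH: "invertible H"
  proof -
    have "stack X (X ** J) = stack (mstar s (H ** Y)) (mstar s (H ** (Ji ** Y)))"
      by (simp only: HY HJiY mstar_mstar)
    also have "\<dots> = stack (mstar s Y) (mstar s (Ji ** Y)) ** mstar s H"
      by (simp only: stack_mult mstar_mult)
    finally have "invertible (mstar s H)"
      using L by (metis invertible_left_inverse matrix_inv_left matrix_mul_assoc)
    then show ?thesis using invertible_mstar mstar_mstar by metis
  qed
  then have H\<Gamma>: "H ** \<Gamma> = mat 1" "\<Gamma> ** H = mat 1"
    by (simp_all add: \<Gamma>_def matrix_inv_left matrix_inv_right)
  show "invertible \<Gamma>" unfolding \<Gamma>_def using invH by (rule invertible_matrix_inv)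
  have \<Gamma>X: "\<Gamma> ** mstar s X = Y"
    using HY H\<Gamma> by (metis matrix_mul_assoc matrix_mul_lid)
  show "X ** \<Gamma> ** mstar s X = 0" using \<Gamma>X XY by (metis matrix_mul_assoc)
  show "X ** J ** \<Gamma> ** mstar s X = matrix_inv A" using \<Gamma>X XJY by (metis matrix_mul_assoc)
  have "mstar s \<Gamma> = matrix_inv (- (\<epsilon> *\<^sub>R H))"
    unfolding \<Gamma>_def by (simp add: mstar_matrix_inv[OF invH] skew)
  also have "\<dots> = - (\<epsilon> *\<^sub>R \<Gamma>)"
    by (rule matrix_inv_eqI) (simp add: matrix_bilinear H\<Gamma> eps)
  finally have "mstar s \<Gamma> = - (\<epsilon> *\<^sub>R \<Gamma>)" .
  moreover have "J ** \<Gamma> = \<Gamma> ** mstar s Ji"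
  proof -
    have "mstar s Ji ** mstar s J = mat 1"
      by (metis JJi(1) mstar_mult mstar_mat_1)
    then have "mstar s Ji ** H = H ** J"
      using JHJ by (metis matrix_mul_assoc matrix_mul_lid)
    then have "\<Gamma> ** (mstar s Ji ** H) ** \<Gamma> = J ** \<Gamma>"
      by (simp add: matrix_mul_assoc H\<Gamma>)
    then show ?thesis by (metis H\<Gamma>(1) matrix_mul_assoc matrix_mul_rid)
  qed
  ultimately show "\<Gamma> \<in> S_set J s \<epsilon>" by (simp add: S_set_def Ji_def)
qed

text \<open>
  Multiplying the equation of the pair by \<open>\<Gamma> X\<^sup>\<star> A\<close> isolates \<open>Q\<close>.
\<close>
lemma middle_coefficient_eq:
  fixes X :: "'a::real_or_complex^'m^'n"
  assumes root: "A ** X ** J ** J + Q ** X ** J + \<epsilon> *\<^sub>R (mstar s A ** X) = 0"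
    and orth: "X ** \<Gamma> ** mstar s X = 0"
    and inv: "X ** J ** \<Gamma> ** mstar s X ** A = mat 1"
  shows "Q = - (A ** X ** (J ** J) ** \<Gamma> ** mstar s X ** A)"
proof -
  have "0 = (A ** X ** J ** J + Q ** X ** J + \<epsilon> *\<^sub>R (mstar s A ** X)) ** \<Gamma> ** mstar s X ** A"
    by (simp add: root)
  also have "\<dots> = A ** X ** (J ** J) ** \<Gamma> ** mstar s X ** A
      + Q ** (X ** J ** \<Gamma> ** mstar s X ** A)
      + \<epsilon> *\<^sub>R (mstar s A ** (X ** \<Gamma> ** mstar s X) ** A)"
    by (simp add: matrix_bilinear matrix_mul_assoc)
  finally show ?thesis by (simp add: orth inv add_eq_0_iff)
qed

section \<open>From the parameter to a standard pair\<close>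

text \<open>
  The congruence avoids the inverse of \<open>J\<close> and lets a factor \<open>J\<close> on the left of \<open>\<Gamma>\<close> cancel against
  a factor \<open>J\<^sup>\<star>\<close> on the right.
\<close>
lemma S_set_congruence:
  assumes J: "invertible J" and \<Gamma>: "\<Gamma> \<in> S_set J s \<epsilon>"
  shows "J ** \<Gamma> ** mstar s J = \<Gamma>"
proof -
  have "mstar s (matrix_inv J) ** mstar s J = mat 1"
    by (metis J matrix_inv_right mstar_mult mstar_mat_1)
  then show ?thesis using \<Gamma> by (simp add: S_set_def flip: matrix_mul_assoc)
qed

text \<open>
  By orthogonality \<open>L \<Gamma> X\<^sup>\<star>\<close> is the stack of \<open>0\<close> over \<open>B = X J \<Gamma> X\<^sup>\<star>\<close>. It has a left inverse,
  as each of its three factors has one: \<open>X\<close> has a right inverse, being a block of \<open>L\<close>. Hence the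
  square matrix \<open>B\<close> has a left inverse, too.
\<close>
lemma invertible_lead_gram:
  fixes X :: "'a::real_or_complex^('n::finite + 'n)^'n"
  assumes L: "invertible (stack X (X ** J))"
    and inv\<Gamma>: "invertible \<Gamma>"
    and orth: "X ** \<Gamma> ** mstar s X = 0"
  shows "invertible (X ** J ** \<Gamma> ** mstar s X)"
proof -
  let ?B = "X ** J ** \<Gamma> ** mstar s X"
  obtain R where R: "X ** R = mat 1" using stack_solvable[OF L] by metis
  then have R': "mstar s R ** mstar s X = mat 1" by (metis mstar_mult mstar_mat_1)
  have "stack X (X ** J) ** \<Gamma> ** mstar s X = stack 0 (mat 1) ** ?B"
    by (simp add: stack_mult orth)
  then have "mstar s R ** matrix_inv \<Gamma> ** matrix_inv (stack X (X ** J)) ** stack 0 (mat 1) ** ?B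
      = mstar s R ** (matrix_inv \<Gamma> ** (matrix_inv (stack X (X ** J)) ** stack X (X ** J)) ** \<Gamma>)
        ** mstar s X"
    by (simp only: flip: matrix_mul_assoc)
  also have "\<dots> = mat 1" using L inv\<Gamma> by (simp add: matrix_inv_left R')
  finally show ?thesis by (auto simp: invertible_left_inverse)
qed

text \<open>
  The residual \<open>E\<close> of the pair vanishes because \<open>E \<Gamma>\<close> annihilates \<open>X\<^sup>\<star>\<close> and
  \<open>J\<^sup>\<star> X\<^sup>\<star>\<close>, the two blocks of \<open>L\<^sup>\<star>\<close>. Only \<open>E \<Gamma> X\<^sup>\<star> = 0\<close> involves the definition of
  \<open>Q\<close>, since \<open>Q\<close> drops out of \<open>E \<Gamma> J\<^sup>\<star> X\<^sup>\<star>\<close> by orthogonality.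
\<close>
lemma standard_pair_of_parameter:
  fixes X :: "'a::real_or_complex^('n::finite + 'n)^'n"
  assumes eps: "\<epsilon> * \<epsilon> = 1"
    and J: "invertible J"
    and L: "invertible (stack X (X ** J))"
    and \<Gamma>: "\<Gamma> \<in> S_set J s \<epsilon>" and inv\<Gamma>: "invertible \<Gamma>"
    and orth: "X ** \<Gamma> ** mstar s X = 0"
    and A: "A = matrix_inv (X ** J ** \<Gamma> ** mstar s X)"
    and Q: "Q = - (A ** X ** (J ** J) ** \<Gamma> ** mstar s X ** A)"
  shows "mstar s Q = \<epsilon> *\<^sub>R Q" "standard_pair (palindromic_poly s \<epsilon> A Q) X J"
proof -
  define B where "B = X ** J ** \<Gamma> ** mstar s X"
  define E where "E = A ** X ** J ** J + Q ** X ** J + \<epsilon> *\<^sub>R (mstar s A ** X)"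
  have invB: "invertible B"
    unfolding B_def by (rule invertible_lead_gram[OF L inv\<Gamma> orth])
  then have AB: "A ** B = mat 1" "B ** A = mat 1"
    unfolding A B_def by (simp_all add: matrix_inv_left matrix_inv_right)
  then have AB': "mstar s A ** mstar s B = mat 1" "mstar s B ** mstar s A = mat 1"
    by (metis mstar_mult mstar_mat_1)+
  have skew: "mstar s \<Gamma> = - (\<epsilon> *\<^sub>R \<Gamma>)" using \<Gamma> by (simp add: S_set_def)
  have JGJ: "J ** \<Gamma> ** mstar s J = \<Gamma>" by (rule S_set_congruence[OF J \<Gamma>])
  have B': "X ** \<Gamma> ** mstar s J ** mstar s X = - (\<epsilon> *\<^sub>R mstar s B)"
    by (simp add: B_def mstar_simps skew matrix_bilinear matrix_mul_assoc eps)
  have EX: "E ** \<Gamma> ** mstar s X = 0"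
  proof -
    have "E ** \<Gamma> ** mstar s X = A ** X ** J ** J ** \<Gamma> ** mstar s X + Q ** B
        + \<epsilon> *\<^sub>R (mstar s A ** (X ** \<Gamma> ** mstar s X))"
      by (simp add: E_def B_def matrix_bilinear matrix_mul_assoc)
    moreover have "Q ** B = - (A ** X ** J ** J ** \<Gamma> ** mstar s X ** (A ** B))"
      by (simp add: Q matrix_bilinear matrix_mul_assoc)
    ultimately show ?thesis by (simp add: orth AB)
  qed
  have EXJ: "E ** \<Gamma> ** mstar s J ** mstar s X = 0"
  proof -
    have "E ** \<Gamma> ** mstar s J ** mstar s X
        = A ** X ** J ** (J ** \<Gamma> ** mstar s J) ** mstar s X
          + Q ** X ** (J ** \<Gamma> ** mstar s J) ** mstar s X
          + \<epsilon> *\<^sub>R (mstar s A ** (X ** \<Gamma> ** mstar s J ** mstar s X))"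
      by (simp add: E_def matrix_bilinear matrix_mul_assoc)
    also have "\<dots> = A ** B + Q ** (X ** \<Gamma> ** mstar s X)
          + \<epsilon> *\<^sub>R (mstar s A ** (- (\<epsilon> *\<^sub>R mstar s B)))"
      unfolding JGJ B' by (simp add: B_def matrix_mul_assoc)
    also have "\<dots> = 0" by (simp add: orth AB AB' matrix_bilinear eps)
    finally show ?thesis .
  qed
  have "mstar s (E ** \<Gamma>) = 0"
  proof (rule stack_left_cancel[OF L])
    show "X ** mstar s (E ** \<Gamma>) = X ** 0"
      using arg_cong[OF EX, of "mstar s"] by (simp add: mstar_simps)
    show "X ** J ** mstar s (E ** \<Gamma>) = X ** J ** 0"
      using arg_cong[OF EXJ, of "mstar s"] by (simp add: mstar_simps matrix_mul_assoc)
  qed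
  then have "E ** \<Gamma> = 0" by (metis mstar_linear(5) mstar_mstar)
  then have E0: "E = 0"
    using inv\<Gamma> by (metis matrix_inv_right matrix_mul_assoc matrix_mul_rid times0_left)
  then show "standard_pair (palindromic_poly s \<epsilon> A Q) X J"
    using L by (simp add: standard_pair_palindromic E_def)
  \<comment> \<open>One more factor \<open>J\<^sup>\<star>\<close> makes the term with \<open>A\<close> vanish instead, which leaves \<open>Q\<close> as a
    product with \<open>A\<^sup>\<star>\<close> on both sides, the star of its definition up to the factor \<open>\<epsilon>\<close>.\<close>
  have "0 = E ** \<Gamma> ** mstar s J ** mstar s J ** mstar s X" by (simp add: E0)
  also have "\<dots> = A ** X ** J ** (J ** \<Gamma> ** mstar s J) ** mstar s J ** mstar s X
      + Q ** X ** (J ** \<Gamma> ** mstar s J) ** mstar s J ** mstar s X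
      + \<epsilon> *\<^sub>R (mstar s A ** (X ** \<Gamma> ** mstar s J ** mstar s J ** mstar s X))"
    by (simp add: E_def matrix_bilinear matrix_mul_assoc)
  also have "\<dots> = A ** (X ** (J ** \<Gamma> ** mstar s J) ** mstar s X)
      + Q ** (X ** \<Gamma> ** mstar s J ** mstar s X)
      + \<epsilon> *\<^sub>R (mstar s A ** (X ** \<Gamma> ** mstar s J ** mstar s J ** mstar s X))"
    by (subst (1 2) JGJ) (simp add: matrix_mul_assoc)
  also have "\<dots> = \<epsilon> *\<^sub>R (mstar s A ** (X ** \<Gamma> ** mstar s J ** mstar s J ** mstar s X) - Q ** mstar s B)"
    unfolding JGJ orth B' by (simp add: matrix_bilinear algebra_simps)
  finally have "Q ** mstar s B = mstar s A ** (X ** \<Gamma> ** mstar s J ** mstar s J ** mstar s X)"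
    using eps by auto
  then have "Q = mstar s A ** (X ** \<Gamma> ** mstar s J ** mstar s J ** mstar s X) ** mstar s A"
    using AB' by (metis matrix_mul_assoc matrix_mul_rid)
  also have "\<dots> = \<epsilon> *\<^sub>R mstar s Q"
    by (simp add: Q mstar_simps skew matrix_bilinear matrix_mul_assoc eps)
  finally show "mstar s Q = \<epsilon> *\<^sub>R Q" using eps by (metis scaleR_one scaleR_scaleR)
qed

section \<open>The correspondence\<close>

theorem theorem2p2:
  fixes X :: "'a::real_or_complex^('n::finite + 'n)^'n"
    and J :: "'a^('n + 'n)^('n + 'n)"
    and s :: star
    and \<epsilon> :: real
  assumes "\<epsilon> \<in> {1, - 1}"
    and "invertible J"
  shows
    "((\<exists>A Q. invertible A \<and> mstar s Q = \<epsilon> *\<^sub>R Q \<and> standard_pair (palindromic_poly s \<epsilon> A Q) X J)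
      \<longleftrightarrow>
      invertible (stack X (X ** J)) \<and>
      (\<exists>\<Gamma> \<in> S_set J s \<epsilon>. invertible \<Gamma> \<and> X ** \<Gamma> ** mstar s X = 0))
     \<and>
     (invertible (stack X (X ** J)) \<longrightarrow>
      (\<forall>\<Gamma> \<in> S_set J s \<epsilon>. invertible \<Gamma> \<and> X ** \<Gamma> ** mstar s X = 0 \<longrightarrow>
        invertible (X ** J ** \<Gamma> ** mstar s X) \<and>
        (\<forall>A Q. A = matrix_inv (X ** J ** \<Gamma> ** mstar s X) \<and>
               Q = - (A ** X ** (J ** J) ** \<Gamma> ** mstar s X ** A) \<longrightarrow>
               invertible A \<and> mstar s Q = \<epsilon> *\<^sub>R Q \<and>
               standard_pair (palindromic_poly s \<epsilon> A Q) X J)))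
     \<and>
     (\<forall>A Q. invertible A \<and> mstar s Q = \<epsilon> *\<^sub>R Q \<and> standard_pair (palindromic_poly s \<epsilon> A Q) X J \<longrightarrow>
        (\<exists>\<Gamma> \<in> S_set J s \<epsilon>. invertible \<Gamma> \<and> X ** \<Gamma> ** mstar s X = 0 \<and>
           invertible (X ** J ** \<Gamma> ** mstar s X) \<and>
           A = matrix_inv (X ** J ** \<Gamma> ** mstar s X) \<and>
           Q = - (A ** X ** (J ** J) ** \<Gamma> ** mstar s X ** A)))"
proof -
  have eps: "\<epsilon> * \<epsilon> = 1" using assms(1) by auto
  have sufficient: "invertible (X ** J ** \<Gamma> ** mstar s X) \<and>
      (\<forall>A Q. A = matrix_inv (X ** J ** \<Gamma> ** mstar s X) \<and>
             Q = - (A ** X ** (J ** J) ** \<Gamma> ** mstar s X ** A) \<longrightarrow>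
             invertible A \<and> mstar s Q = \<epsilon> *\<^sub>R Q \<and>
             standard_pair (palindromic_poly s \<epsilon> A Q) X J)"
    if "invertible (stack X (X ** J))" "\<Gamma> \<in> S_set J s \<epsilon>"
      "invertible \<Gamma> \<and> X ** \<Gamma> ** mstar s X = 0" for \<Gamma>
    using that invertible_lead_gram[of X J \<Gamma> s] invertible_matrix_inv
      standard_pair_of_parameter[OF eps assms(2), of X \<Gamma> s]
    by metis
  have necessary: "\<exists>\<Gamma> \<in> S_set J s \<epsilon>. invertible \<Gamma> \<and> X ** \<Gamma> ** mstar s X = 0 \<and>
      invertible (X ** J ** \<Gamma> ** mstar s X) \<and>
      A = matrix_inv (X ** J ** \<Gamma> ** mstar s X) \<and>
      Q = - (A ** X ** (J ** J) ** \<Gamma> ** mstar s X ** A)"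
    if *: "invertible A" "mstar s Q = \<epsilon> *\<^sub>R Q" "standard_pair (palindromic_poly s \<epsilon> A Q) X J" for A Q
  proof -
    obtain \<Gamma> where \<Gamma>: "\<Gamma> \<in> S_set J s \<epsilon>" "invertible \<Gamma>" "X ** \<Gamma> ** mstar s X = 0"
      "X ** J ** \<Gamma> ** mstar s X = matrix_inv A"
      using parameter_of_standard_pair[OF eps assms(2) *] by blast
    have "A = matrix_inv (matrix_inv A)"
      by (rule sym, rule matrix_inv_eqI, rule matrix_inv_left[OF *(1)])
    moreover have "Q = - (A ** X ** (J ** J) ** \<Gamma> ** mstar s X ** A)"
      using *(1,3) \<Gamma>(3,4)
      by (intro middle_coefficient_eq[where \<epsilon> = \<epsilon>]) (simp_all add: standard_pair_palindromic matrix_inv_left)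
    ultimately show ?thesis using \<Gamma> *(1) invertible_matrix_inv by (intro bexI[of _ \<Gamma>]) auto
  qed
  have pair_invertible: "invertible (stack X (X ** J))"
    if "standard_pair P X J" for P using that by (simp add: standard_pair_def)
  have "(\<exists>A Q. invertible A \<and> mstar s Q = \<epsilon> *\<^sub>R Q \<and> standard_pair (palindromic_poly s \<epsilon> A Q) X J)
      \<longleftrightarrow> invertible (stack X (X ** J)) \<and>
        (\<exists>\<Gamma> \<in> S_set J s \<epsilon>. invertible \<Gamma> \<and> X ** \<Gamma> ** mstar s X = 0)" (is "?L \<longleftrightarrow> ?R")
  proof
    assume ?L
    then show ?R using necessary pair_invertible by metis
  next
    assume ?R
    then show ?L using sufficient by blast
  qed
  then show ?thesis using sufficient necessary by (intro conjI impI ballI allI) simp_all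
qed

end
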